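(* Let $n\ge 2$, $1<p<\infty$, let $G\subset\mathbb{R}^n$ be open and connected, and let $u\in C^1(G)$. Suppose there exist two concentric open balls $B_{r_b}=B(z,r_b)$ and $B_{R_b}=B(z,R_b)$, $0<r_b<R_b$, with $B_{r_b}\subset\overline{B}_{R_b}\subset G$, such that $I(r)>0$ for every $r\in(r_b,R_b]$ (so that the frequency function $F_p(r)$ is defined there) and $\|F_p\|_{L^\infty((r_b,R_b])}<\infty$. Then there exists some $r^\star\in(r_b,R_b]$ such that $$\int_{\partial B_{r_1}}|u|^p\,dS\le 4\int_{\partial B_{r_2}}|u|^p\,dS\qquad\text{for every } r_1,r_2\in(r_b,r^\star].$$ In particular, $$\int_{\partial B_{r^\star}}|u|^p\,dS\le 4\int_{\partial B_{r}}|u|^p\,dS\qquad\text{for every } r\in(r_b,r^\star].$$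
   Context: $B_r=B(z,r)$ denotes the open ball of radius $r$ centered at the fixed point $z\in G$; $dS$ is the surface element on $\partial B_r$. For $\overline{B}_r\subset G$ set $I(r)=\int_{\partial B_r}|u|^p\,dS$ and $D(r)=\int_{B_r}|\nabla u|^p\,dx$. The frequency function is $$F_p(r)=\frac{r\,D(r)}{I(r)}=\frac{r\int_{B_r}|\nabla u|^p\,dx}{\int_{\partial B_r}|u|^p\,dS},$$ defined for those $r$ with $I(r)>0$. *)

theory Defs
  imports "HOL-Analysis.Analysis" "HOL-Probability.Essential_Supremum"
begin

text \<open>
  The surface measure \<open>dS\<close> on the sphere of radius \<open>r > 0\<close> about \<open>z\<close> in \<open>n\<close>-dimensional
  space, as in the usual treatment of polar coordinates: the area of a Borel set \<open>A\<close> of the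
  sphere is \<open>n / r\<close> times the Lebesgue measure of the solid cone \<open>{z + t (x - z) | x \<in> A, 0 < t \<le> 1}\<close>.
  It is written as the image of Lebesgue measure on the punctured ball under radial projection;
  the lemmas below give the cone formula and the total area.
  The space of this measure is the sphere itself, so an integrand only needs to be
  measurable there, whatever its values elsewhere.
\<close>

definition radial_proj :: "'a::euclidean_space \<Rightarrow> real \<Rightarrow> 'a \<Rightarrow> 'a" where
  "radial_proj z r y = z + (r / norm (y - z)) *\<^sub>R (y - z)"

definition sphere_measure :: "'a::euclidean_space \<Rightarrow> real \<Rightarrow> 'a measure" where
  "sphere_measure z r =
     scale_measure (ennreal (real DIM('a) / r))
       (distr (restrict_space lborel (cball z r - {z})) (restrict_space borel (sphere z r))
          (radial_proj z r))"

lemma space_sphere_measure: "space (sphere_measure z r) = sphere z r"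
  by (simp add: sphere_measure_def space_scale_measure space_restrict_space)

lemma sets_sphere_measure: "sets (sphere_measure z r) = sets (restrict_space borel (sphere z r))"
  by (simp add: sphere_measure_def)

lemma radial_proj_in_sphere:
  assumes "r > 0" "y \<noteq> z"
  shows "radial_proj z r y \<in> sphere z r"
  using assms by (simp add: radial_proj_def dist_norm)

lemma measurable_radial_proj:
  fixes z :: "'a::euclidean_space"
  assumes "r > 0"
  shows "radial_proj z r \<in>
    restrict_space lborel (cball z r - {z}) \<rightarrow>\<^sub>M restrict_space borel (sphere z r)"
proof (rule measurable_restrict_space2)
  show "radial_proj z r \<in> space (restrict_space lborel (cball z r - {z})) \<rightarrow> sphere z r"
    using radial_proj_in_sphere[OF assms, of _ z] by (auto simp: space_restrict_space simp del: mem_sphere)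
  have "radial_proj z r \<in> borel_measurable lborel"
    unfolding radial_proj_def by measurable
  then show "radial_proj z r \<in> restrict_space lborel (cball z r - {z}) \<rightarrow>\<^sub>M borel"
    by (rule measurable_restrict_space1)
qed

lemma radial_proj_vimage:
  assumes r: "r > 0" and A: "A \<subseteq> sphere z r"
  shows "radial_proj z r -` A \<inter> (cball z r - {z}) = {z + t *\<^sub>R (x - z) | x t. x \<in> A \<and> 0 < t \<and> t \<le> 1}"
    (is "?L = ?R")
proof (intro set_eqI iffI)
  fix y assume y: "y \<in> ?L"
  then have n: "norm (y - z) > 0" "norm (y - z) \<le> r"
    by (auto simp: dist_norm norm_minus_commute)
  have "y = z + (norm (y - z) / r) *\<^sub>R (radial_proj z r y - z)"
    using n r by (simp add: radial_proj_def)
  moreover have "0 < norm (y - z) / r" "norm (y - z) / r \<le> 1"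
    using n r by auto
  ultimately show "y \<in> ?R" using y by blast
next
  fix y assume "y \<in> ?R"
  then obtain x t where xt: "y = z + t *\<^sub>R (x - z)" "x \<in> A" "0 < t" "t \<le> 1" by blast
  have nx: "norm (x - z) = r" using xt(2) A by (auto simp: dist_norm norm_minus_commute)
  then have "radial_proj z r y = x"
    using xt r by (auto simp: radial_proj_def)
  moreover have "norm (y - z) = t * r" using xt nx by simp
  then have "0 < norm (y - z)" "norm (y - z) \<le> r"
    using xt r by (auto intro: mult_left_le_one_le)
  ultimately show "y \<in> ?L" using xt by (auto simp: dist_norm norm_minus_commute)
qed

lemma emeasure_sphere_measure:
  fixes z :: "'a::euclidean_space"
  assumes r: "r > 0" and A: "A \<in> sets borel" "A \<subseteq> sphere z r"
  shows "emeasure (sphere_measure z r) A =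
    ennreal (real DIM('a) / r) * emeasure lborel {z + t *\<^sub>R (x - z) | x t. x \<in> A \<and> 0 < t \<and> t \<le> 1}"
proof -
  have "A \<in> sets (restrict_space borel (sphere z r))"
    using A by (auto simp: sets_restrict_space)
  then show ?thesis
    using measurable_radial_proj[OF r, of z] radial_proj_vimage[OF r A(2)]
    by (simp add: sphere_measure_def emeasure_distr space_restrict_space
        emeasure_restrict_space) (auto intro!: arg_cong2[where f="(*)"] emeasure_restrict_space)
qed

lemma emeasure_sphere_measure_sphere:
  fixes z :: "'a::euclidean_space"
  assumes r: "r > 0"
  shows "emeasure (sphere_measure z r) (sphere z r) =
    ennreal (real DIM('a) * unit_ball_vol (real DIM('a)) * r ^ (DIM('a) - 1))"
proof -
  have eq: "radial_proj z r -` sphere z r \<inter> (cball z r - {z}) = cball z r - {z}"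
    using radial_proj_in_sphere[OF r] by auto
  have "emeasure lborel (cball z r - {z}) = emeasure lborel (cball z r)"
    by (rule emeasure_Diff_null_set) auto
  then have "emeasure (sphere_measure z r) (sphere z r) =
      ennreal (real DIM('a) / r) * ennreal (unit_ball_vol (real DIM('a)) * r ^ DIM('a))"
    using r emeasure_sphere_measure[OF r, of "sphere z r" z] radial_proj_vimage[OF r, of "sphere z r" z] eq
    by (simp add: emeasure_cball)
  also have "\<dots> = ennreal (real DIM('a) / r * (unit_ball_vol (real DIM('a)) * r ^ DIM('a)))"
    using r by (subst ennreal_mult) auto
  also have "real DIM('a) / r * (unit_ball_vol (real DIM('a)) * r ^ DIM('a)) =
      real DIM('a) * unit_ball_vol (real DIM('a)) * r ^ (DIM('a) - 1)"
    using r by (simp add: power_eq_if)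
  finally show ?thesis .
qed

definition gradient :: "('a::euclidean_space \<Rightarrow> real) \<Rightarrow> 'a \<Rightarrow> 'a" where
  "gradient u x = (THE D. GDERIV u x :> D)"

definition C1_on :: "'a::euclidean_space set \<Rightarrow> ('a \<Rightarrow> real) \<Rightarrow> bool" where
  "C1_on G u \<longleftrightarrow> (\<forall>x\<in>G. u differentiable (at x)) \<and> continuous_on G (gradient u)"

lemma gradient_eqI:
  assumes "GDERIV u x :> D"
  shows "gradient u x = D"
  unfolding gradient_def
proof (rule the_equality)
  show "GDERIV u x :> D" by (fact assms)
next
  fix E assume "GDERIV u x :> E"
  then have "(\<lambda>h. inner h E) = (\<lambda>h. inner h D)"
    using assms unfolding gderiv_def by (rule has_derivative_unique)
  then show "E = D" by (metis inner_commute vector_eq_rdot)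
qed

lemma GDERIV_gradient:
  fixes u :: "'a::euclidean_space \<Rightarrow> real"
  assumes "u differentiable (at x)"
  shows "GDERIV u x :> gradient u x"
proof -
  obtain f' where f': "(u has_derivative f') (at x)"
    using assms by (auto simp: differentiable_def)
  then interpret linear f' by (rule has_derivative_linear)
  define D where "D = adjoint f' 1"
  have "f' h = inner h D" for h
    using adjoint_works[OF linear_axioms, of h 1] by (simp add: D_def)
  then have "f' = (\<lambda>h. inner h D)" by (rule ext)
  then have "GDERIV u x :> D"
    using f' by (simp add: gderiv_def)
  then show ?thesis using gradient_eqI by metis
qed

text \<open>
  \<open>I(r)\<close>, \<open>D(r)\<close> and \<open>F\<^sub>p(r)\<close>, meaningful for \<open>r > 0\<close> with the closed ball inside the domain
  on which \<open>u\<close> is \<open>C\<^sup>1\<close>; \<open>frequency\<close> takes the value \<open>0\<close> where \<open>I(r) = 0\<close>.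
\<close>

definition sphere_energy :: "real \<Rightarrow> ('a::euclidean_space \<Rightarrow> real) \<Rightarrow> 'a \<Rightarrow> real \<Rightarrow> real" where
  "sphere_energy p u z r = (\<integral>x. \<bar>u x\<bar> powr p \<partial>sphere_measure z r)"

definition dirichlet_energy :: "real \<Rightarrow> ('a::euclidean_space \<Rightarrow> real) \<Rightarrow> 'a \<Rightarrow> real \<Rightarrow> real" where
  "dirichlet_energy p u z r = (LINT x:ball z r|lebesgue. norm (gradient u x) powr p)"

definition frequency :: "real \<Rightarrow> ('a::euclidean_space \<Rightarrow> real) \<Rightarrow> 'a \<Rightarrow> real \<Rightarrow> real" where
  "frequency p u z r = r * dirichlet_energy p u z r / sphere_energy p u z r"

definition Linfty_norm :: "real set \<Rightarrow> (real \<Rightarrow> real) \<Rightarrow> ereal" where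
  "Linfty_norm S f = esssup (lebesgue_on S) (\<lambda>r. ereal \<bar>f r\<bar>)"

end

theory Submission
  imports Defs
begin

text \<open>
  \<open>I\<close> is continuous up to \<open>r\<^sub>b\<close>, so the comparison near \<open>r\<^sub>b\<close> is immediate once \<open>I(r\<^sub>b) > 0\<close>. If
  \<open>I(r\<^sub>b) = 0\<close>, then \<open>u\<close> vanishes on the inner sphere, and integrating \<open>\<nabla>u\<close> along rays gives a
  Poincare inequality \<open>I(r) \<le> K (r - r\<^sub>b)\<^bsup>p-1\<^esup> D(r)\<close>. Together with \<open>r D(r) \<le> M I(r)\<close>, which
  holds for almost every \<open>r\<close>, this yields \<open>r\<^sub>b \<le> K M (r - r\<^sub>b)\<^bsup>p-1\<^esup>\<close>, impossible for \<open>r\<close> close to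
  \<open>r\<^sub>b\<close>. Polar coordinates are avoided: functions of the direction alone are averaged over solid
  annuli, and only linear dilations and Tonelli's theorem are needed.
\<close>

section \<open>Affine substitution and Jensen's inequality on an interval\<close>

lemma nn_integral_lborel_affine:
  fixes f :: "'a::euclidean_space \<Rightarrow> ennreal"
  assumes [measurable]: "f \<in> borel_measurable borel" and c: "c > 0"
  shows "(\<integral>\<^sup>+x. f x \<partial>lborel) = ennreal (c ^ DIM('a)) * (\<integral>\<^sup>+x. f (t + c *\<^sub>R x) \<partial>lborel)"
  using c by (subst lborel_affine[of c t])
    (simp_all add: nn_integral_density nn_integral_distr nn_integral_cmult)

text \<open>Convexity gives this for positive \<open>m\<close> and \<open>x\<close>. The endpoint 0
  is treated by hand: for \<open>m = 0\<close> the left side vanishes, and for \<open>x = 0\<close>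
  it equals (1 - p) m^p, which is at most 0.\<close>

lemma powr_above_tangent:
  fixes x m p :: real
  assumes "x \<ge> 0" "m \<ge> 0" "p > 1"
  shows "m powr p + p * m powr (p - 1) * (x - m) \<le> x powr p"
proof (cases "m = 0 \<or> x = 0")
  case True
  have "m powr p = m powr (p - 1) * m"
    using assms by (cases "m = 0") (auto simp: powr_diff)
  moreover have "m powr p \<le> p * m powr p"
    using assms by (simp add: mult_left_le_one_le mult_le_cancel_right1)
  ultimately show ?thesis
    using True assms by auto
next
  case False
  have "((\<lambda>x. x powr p) has_field_derivative p * m powr (p - 1)) (at m within {0<..})"
    using False assms by (auto intro!: derivative_eq_intros)
  then have "x powr p - m powr p \<ge> p * m powr (p - 1) * (x - m)"
    using False assms
    by (intro convex_on_imp_above_tangent[OF powr_convex]) (auto simp: interior_open)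
  then show ?thesis by simp
qed

text \<open>
  Jensen's inequality for the mean slope \<open>m\<close>, by integrating the tangent line of \<open>x \<mapsto> x powr p\<close> at \<open>m\<close>.
\<close>

lemma abs_diff_powr_le_integral:
  fixes v v' :: "real \<Rightarrow> real"
  assumes ab: "a < b" and p: "p > 1"
    and v: "\<And>t. t \<in> {a..b} \<Longrightarrow> (v has_real_derivative v' t) (at t within {a..b})"
    and v': "continuous_on {a..b} v'"
  shows "\<bar>v b - v a\<bar> powr p \<le> (b - a) powr (p - 1) * integral {a..b} (\<lambda>t. \<bar>v' t\<bar> powr p)"
proof -
  define m where "m = \<bar>v b - v a\<bar> / (b - a)"
  \<comment> \<open>With this sign the mean of \<open>\<sigma> * v'\<close> over the interval is
    exactly \<open>m\<close>, so the linear term of the tangent line integrates to 0.\<close>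
  define \<sigma> where "\<sigma> = sgn (v b - v a)"
  have m0: "m \<ge> 0" using ab by (simp add: m_def)
  have ftc: "(v' has_integral (v b - v a)) {a..b}"
    using ab v by (intro fundamental_theorem_of_calculus)
      (auto simp: has_real_derivative_iff_has_vector_derivative)
  have "((\<lambda>t. m powr p + p * m powr (p - 1) * (\<sigma> * v' t - m)) has_integral
      ((b - a) * m powr p + p * m powr (p - 1) * (\<sigma> * (v b - v a) - (b - a) * m))) {a..b}"
    using ab has_integral_const_real[of "m powr p" a b] has_integral_const_real[of m a b]
    by (intro has_integral_add has_integral_diff has_integral_mult_right ftc) auto
  moreover have "\<sigma> * (v b - v a) - (b - a) * m = 0"
    using ab by (auto simp: \<sigma>_def m_def abs_sgn mult.commute)
  ultimately have lhs: "((\<lambda>t. m powr p + p * m powr (p - 1) * (\<sigma> * v' t - m)) has_integral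
      (b - a) * m powr p) {a..b}" by simp
  have "continuous_on {a..b} (\<lambda>t. \<bar>v' t\<bar> powr p)"
    using p by (intro continuous_intros continuous_on_powr' v') auto
  then have rhs: "((\<lambda>t. \<bar>v' t\<bar> powr p) has_integral integral {a..b} (\<lambda>t. \<bar>v' t\<bar> powr p)) {a..b}"
    by (intro integrable_integral integrable_continuous_real)
  have "(b - a) * m powr p \<le> integral {a..b} (\<lambda>t. \<bar>v' t\<bar> powr p)"
  proof (rule has_integral_le[OF lhs rhs])
    fix t assume "t \<in> {a..b}"
    have "\<sigma> * v' t \<le> \<bar>v' t\<bar>"
      by (auto simp: \<sigma>_def sgn_if)
    then have "p * m powr (p - 1) * (\<sigma> * v' t - m) \<le> p * m powr (p - 1) * (\<bar>v' t\<bar> - m)"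
      using p by (intro mult_left_mono) auto
    then show "m powr p + p * m powr (p - 1) * (\<sigma> * v' t - m) \<le> \<bar>v' t\<bar> powr p"
      using powr_above_tangent[of "\<bar>v' t\<bar>" m p] m0 p by linarith
  qed
  then have "(b - a) powr (p - 1) * ((b - a) * m powr p) \<le>
      (b - a) powr (p - 1) * integral {a..b} (\<lambda>t. \<bar>v' t\<bar> powr p)"
    by (intro mult_left_mono) auto
  moreover have "(b - a) powr (p - 1) * ((b - a) * m powr p) = ((b - a) * m) powr p"
    using ab m0 by (simp add: powr_mult powr_diff)
  moreover have "(b - a) * m = \<bar>v b - v a\<bar>"
    using ab by (simp add: m_def)
  ultimately show ?thesis by simp
qed

section \<open>Sphere integrals pulled back to the unit ball\<close>

text \<open>The substitution y = z + r x has Jacobian r^n, which together with the factor n / r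
  gives n r^(n-1). All radii then share one domain of integration and \<open>r\<close> survives only
  in the integrand. The origin is removed because \<open>sgn 0 = 0\<close> would give the centre,
  which is not on the sphere.\<close>

lemma nn_integral_sphere_measure:
  fixes f :: "'a::euclidean_space \<Rightarrow> real"
  assumes r: "r > 0" and f: "continuous_on (sphere z r) f"
  shows "(\<integral>\<^sup>+x. ennreal (f x) \<partial>sphere_measure z r) = ennreal (real DIM('a) * r ^ (DIM('a) - 1)) *
    (\<integral>\<^sup>+x. ennreal (indicator (cball 0 1 - {0}) x *\<^sub>R f (z + r *\<^sub>R sgn x)) \<partial>lborel)"
proof -
  define F where "F y = ennreal (indicator (cball z r - {z}) y *\<^sub>R f (radial_proj z r y))" for y
  have f_meas: "f \<in> borel_measurable (restrict_space borel (sphere z r))"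
    using f by (rule borel_measurable_continuous_on_restrict)
  have "continuous_on (cball z r - {z}) (\<lambda>y. f (radial_proj z r y))"
  proof (rule continuous_on_compose2[OF f])
    show "continuous_on (cball z r - {z}) (radial_proj z r)"
      unfolding radial_proj_def by (intro continuous_intros) auto
    show "radial_proj z r ` (cball z r - {z}) \<subseteq> sphere z r"
      using radial_proj_in_sphere[OF r, of _ z] by (auto simp del: mem_sphere)
  qed
  then have F_meas: "F \<in> borel_measurable borel"
    unfolding F_def by (intro measurable_compose[OF _ measurable_ennreal]
        borel_measurable_continuous_on_indicator) auto
  have "(\<integral>\<^sup>+x. ennreal (f x) \<partial>sphere_measure z r) =
      ennreal (DIM('a) / r) * (\<integral>\<^sup>+y. ennreal (f (radial_proj z r y)) \<partial>restrict_space lborel (cball z r - {z}))"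
    unfolding sphere_measure_def using f_meas measurable_radial_proj[OF r, of z]
    by (subst nn_integral_scale_measure) (auto simp: nn_integral_distr)
  also have "(\<integral>\<^sup>+y. ennreal (f (radial_proj z r y)) \<partial>restrict_space lborel (cball z r - {z})) =
      (\<integral>\<^sup>+y. F y \<partial>lborel)"
    by (subst nn_integral_restrict_space) (auto simp: F_def indicator_def intro!: nn_integral_cong)
  also have "\<dots> = ennreal (r ^ DIM('a)) * (\<integral>\<^sup>+x. F (z + r *\<^sub>R x) \<partial>lborel)"
    by (rule nn_integral_lborel_affine[OF F_meas r])
  also have "(\<integral>\<^sup>+x. F (z + r *\<^sub>R x) \<partial>lborel) =
      (\<integral>\<^sup>+x. ennreal (indicator (cball 0 1 - {0}) x *\<^sub>R f (z + r *\<^sub>R sgn x)) \<partial>lborel)"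
    using r by (intro nn_integral_cong)
      (auto simp: F_def radial_proj_def indicator_def dist_norm sgn_div_norm field_simps)
  finally have "(\<integral>\<^sup>+x. ennreal (f x) \<partial>sphere_measure z r) =
      ennreal (DIM('a) / r) * ennreal (r ^ DIM('a)) *
      (\<integral>\<^sup>+x. ennreal (indicator (cball 0 1 - {0}) x *\<^sub>R f (z + r *\<^sub>R sgn x)) \<partial>lborel)"
    by (simp only: mult.assoc)
  moreover have "ennreal (DIM('a) / r) * ennreal (r ^ DIM('a)) = ennreal (DIM('a) / r * r ^ DIM('a))"
    using r by (intro ennreal_mult[symmetric]) auto
  moreover have "DIM('a) / r * r ^ DIM('a) = DIM('a) * r ^ (DIM('a) - 1)"
    using r by (simp add: power_eq_if)
  ultimately show ?thesis by simp
qed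

text \<open>Both Bochner integrals are \<open>enn2real\<close> of the corresponding nonnegative
  integrals. This takes only measurability and nonnegativity, so integrability need not be
  checked.\<close>

lemma integral_sphere_measure:
  fixes f :: "'a::euclidean_space \<Rightarrow> real"
  assumes r: "r > 0" and f: "continuous_on (sphere z r) f" and f0: "\<And>x. x \<in> sphere z r \<Longrightarrow> f x \<ge> 0"
  shows "(\<integral>x. f x \<partial>sphere_measure z r) = real DIM('a) * r ^ (DIM('a) - 1) *
    (\<integral>x. indicator (cball 0 1 - {0}) x *\<^sub>R f (z + r *\<^sub>R sgn x) \<partial>lborel)"
proof -
  have meas: "f \<in> borel_measurable (sphere_measure z r)"
    using borel_measurable_continuous_on_restrict[OF f] sets_sphere_measure[of z r]
      measurable_cong_sets by blast
  have "continuous_on (cball 0 1 - {0}) (\<lambda>x. f (z + r *\<^sub>R sgn x))"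
    using r by (intro continuous_on_compose2[OF f] continuous_intros)
      (auto simp: dist_norm norm_sgn split: if_splits)
  then have "(\<lambda>x. indicator (cball 0 1 - {0}) x *\<^sub>R f (z + r *\<^sub>R sgn x)) \<in> borel_measurable borel"
    by (intro borel_measurable_continuous_on_indicator) auto
  then have meas': "(\<lambda>x. indicator (cball 0 1 - {0}) x *\<^sub>R f (z + r *\<^sub>R sgn x)) \<in> borel_measurable lborel"
    by simp
  have "(\<integral>x. f x \<partial>sphere_measure z r) = enn2real (\<integral>\<^sup>+x. ennreal (f x) \<partial>sphere_measure z r)"
    using f0 by (intro integral_eq_nn_integral[OF meas] AE_I2) (simp add: space_sphere_measure)
  also have "\<dots> = real DIM('a) * r ^ (DIM('a) - 1) * 
     enn2real (\<integral>\<^sup>+x. ennreal (indicator (cball 0 1 - {0}) x *\<^sub>R f (z + r *\<^sub>R sgn x)) \<partial>lborel)"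
    using r by (subst nn_integral_sphere_measure[OF r f]) (simp add: enn2real_mult)
  also have "enn2real (\<integral>\<^sup>+x. ennreal (indicator (cball 0 1 - {0}) x *\<^sub>R f (z + r *\<^sub>R sgn x)) \<partial>lborel) =
     (\<integral>x. indicator (cball 0 1 - {0}) x *\<^sub>R f (z + r *\<^sub>R sgn x) \<partial>lborel)"
    using r f0 by (intro integral_eq_nn_integral[symmetric, OF meas'] AE_I2)
      (auto simp: indicator_def dist_norm norm_sgn split: if_splits)
  finally show ?thesis .
qed

section \<open>Averages over annuli and over dilations\<close>

text \<open>
  Stated additively because subtraction on \<^typ>\<open>ennreal\<close> is only meaningful for finite integrals.
\<close>

lemma nn_integral_annulus_homogeneous:
  fixes h :: "'a::euclidean_space \<Rightarrow> ennreal"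
  assumes [measurable]: "h \<in> borel_measurable borel"
    and hom: "\<And>t x. t > 0 \<Longrightarrow> h (t *\<^sub>R x) = h x" and ab: "0 < a" "a \<le> b"
  shows "ennreal (b ^ DIM('a)) * (\<integral>\<^sup>+x. indicator (cball 0 1) x * h x \<partial>lborel) =
    ennreal (a ^ DIM('a)) * (\<integral>\<^sup>+x. indicator (cball 0 1) x * h x \<partial>lborel) +
    (\<integral>\<^sup>+x. indicator (cball 0 b - cball 0 a) x * h x \<partial>lborel)"
proof -
  have scale: "(\<integral>\<^sup>+x. indicator (cball 0 s) x * h x \<partial>lborel) =
      ennreal (s ^ DIM('a)) * (\<integral>\<^sup>+x. indicator (cball 0 1) x * h x \<partial>lborel)" if "s > 0" for s
  proof -
    have "(\<lambda>x. indicator (cball 0 s) x * h x) \<in> borel_measurable borel"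
      by (intro borel_measurable_times_ennreal borel_measurable_indicator assms(1)) auto
    from nn_integral_lborel_affine[OF this that, of 0] show ?thesis
      using that by (simp add: hom indicator_def)
  qed
  have [measurable]: "(\<lambda>x. indicator (cball 0 a) x * h x) \<in> borel_measurable borel"
    "(\<lambda>x. indicator (cball 0 b - cball 0 a) x * h x) \<in> borel_measurable borel"
    by (intro borel_measurable_times_ennreal borel_measurable_indicator assms(1); auto)+
  have "(\<integral>\<^sup>+x. indicator (cball 0 b) x * h x \<partial>lborel) = (\<integral>\<^sup>+x. indicator (cball 0 a) x * h x +
      indicator (cball 0 b - cball 0 a) x * h x \<partial>lborel)"
    using ab by (intro nn_integral_cong) (auto simp: indicator_def)
  also have "\<dots> = (\<integral>\<^sup>+x. indicator (cball 0 a) x * h x \<partial>lborel) +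
      (\<integral>\<^sup>+x. indicator (cball 0 b - cball 0 a) x * h x \<partial>lborel)"
    by (rule nn_integral_add) measurable
  finally show ?thesis
    using ab scale[of a] scale[of b] by simp
qed

text \<open>This replaces polar coordinates: integrals along rays, averaged over the base point, are
  controlled by one volume integral. After Tonelli, the inner integral at a fixed \<open>t\<close>
  is t^(-n) times the integral of \<open>g\<close>, and t^(-n) is at most a^(-n).\<close>

lemma nn_integral_dilations_le:
  fixes g :: "'a::euclidean_space \<Rightarrow> ennreal"
  assumes [measurable]: "g \<in> borel_measurable borel" and ab: "0 < a" "a \<le> b"
  shows "(\<integral>\<^sup>+x. (\<integral>\<^sup>+t. indicator {a..b} t * g (t *\<^sub>R x) \<partial>lborel) \<partial>lborel) \<le>
    ennreal ((b - a) / a ^ DIM('a)) * (\<integral>\<^sup>+x. g x \<partial>lborel)"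
proof -
  have "(\<integral>\<^sup>+x. (\<integral>\<^sup>+t. indicator {a..b} t * g (t *\<^sub>R x) \<partial>lborel) \<partial>lborel) =
      (\<integral>\<^sup>+t. (\<integral>\<^sup>+x. indicator {a..b} t * g (t *\<^sub>R x) \<partial>lborel) \<partial>lborel)"
    by (rule lborel_pair.Fubini') measurable
  also have "\<dots> \<le> (\<integral>\<^sup>+t. ennreal (1 / a ^ DIM('a)) * (\<integral>\<^sup>+x. g x \<partial>lborel) * indicator {a..b} t \<partial>lborel)"
  proof (rule nn_integral_mono)
    fix t :: real
    show "(\<integral>\<^sup>+x. indicator {a..b} t * g (t *\<^sub>R x) \<partial>lborel) \<le>
      ennreal (1 / a ^ DIM('a)) * (\<integral>\<^sup>+x. g x \<partial>lborel) * indicator {a..b} t"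
    proof (cases "t \<in> {a..b}")
      case True
      then have "a ^ DIM('a) \<le> t ^ DIM('a)"
        using ab by (intro power_mono) auto
      \<comment> \<open>Inserting (t / a)^n, which is at least 1, supplies the Jacobian t^n that
        turns the integral of g(t x) into that of g.\<close>
      then have "1 \<le> 1 / a ^ DIM('a) * t ^ DIM('a)"
        using ab by (simp add: field_simps)
      then have "1 * (\<integral>\<^sup>+x. g (t *\<^sub>R x) \<partial>lborel) \<le>
          ennreal (1 / a ^ DIM('a) * t ^ DIM('a)) * (\<integral>\<^sup>+x. g (t *\<^sub>R x) \<partial>lborel)"
        by (intro mult_right_mono) auto
      also have "\<dots> = ennreal (1 / a ^ DIM('a)) * (\<integral>\<^sup>+x. g x \<partial>lborel)"
        using True ab nn_integral_lborel_affine[of g t 0]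
          ennreal_mult[of "1 / a ^ DIM('a)" "t ^ DIM('a)"]
        by (simp add: mult.assoc del: times_divide_eq_left)
      finally show ?thesis using True by simp
    qed simp
  qed
  also have "\<dots> = ennreal (1 / a ^ DIM('a)) * (\<integral>\<^sup>+x. g x \<partial>lborel) * ennreal (b - a)"
    using ab by (simp add: nn_integral_cmult)
  also have "\<dots> = ennreal ((b - a) / a ^ DIM('a)) * (\<integral>\<^sup>+x. g x \<partial>lborel)"
    using ab by (simp add: ennreal_mult'[symmetric] mult_ac)
  finally show ?thesis .
qed

section \<open>From rays to an estimate between two spheres\<close>

lemma C1_on_GDERIV:
  "C1_on G u \<Longrightarrow> x \<in> G \<Longrightarrow> GDERIV u x :> gradient u x"
  by (simp add: C1_on_def GDERIV_gradient)

lemma C1_on_imp_continuous_on: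
  assumes "C1_on G u"
  shows "continuous_on G u"
  using assms by (intro continuous_at_imp_continuous_on ballI)
    (auto simp: C1_on_def differentiable_imp_continuous_within)

lemma sphere_energy_eq_enn2real:
  fixes u :: "'a::euclidean_space \<Rightarrow> real"
  assumes u: "continuous_on (sphere z r) u" and r: "r > 0" and p: "p > 0"
  shows "sphere_energy p u z r = enn2real (ennreal (real DIM('a) * r ^ (DIM('a) - 1)) *
    (\<integral>\<^sup>+x. ennreal (indicator (cball 0 1 - {0}) x *\<^sub>R \<bar>u (z + r *\<^sub>R sgn x)\<bar> powr p) \<partial>lborel))"
proof -
  have c: "continuous_on (sphere z r) (\<lambda>x. \<bar>u x\<bar> powr p)"
    using p by (intro continuous_on_powr' continuous_intros u) auto
  have "(\<lambda>x. \<bar>u x\<bar> powr p) \<in> borel_measurable (sphere_measure z r)"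
    using borel_measurable_continuous_on_restrict[OF c] sets_sphere_measure[of z r]
      measurable_cong_sets by blast
  then show ?thesis
    unfolding sphere_energy_def
    by (subst integral_eq_nn_integral) (auto simp: nn_integral_sphere_measure[OF r c])
qed

text \<open>The ray through \<open>x\<close> meets the two spheres at the parameters a / |x| and b /
  |x|; \<open>u\<close> vanishes at the first, so the one-dimensional inequality controls its value
  at the second. These limits depend on \<open>x\<close>. The bound is therefore stated on the fixed
  interval from a / b to b / a, which contains them whenever a < |x| \<le> b and suits Tonelli; the
  indicator of the annulus restores the actual range.\<close>

lemma ray_powr_le_nn_integral:
  fixes u :: "'a::euclidean_space \<Rightarrow> real"
  assumes u: "C1_on G u" and G: "cball z b \<subseteq> G" and ab: "0 < a" "a < b" and p: "p > 1"
    and zero: "\<And>x. x \<in> sphere z a \<Longrightarrow> u x = 0" and x: "x \<in> cball 0 b - cball 0 a"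
  shows "ennreal (\<bar>u (z + b *\<^sub>R sgn x)\<bar> powr p) \<le> ennreal ((b - a) powr (p - 1) * b) *
    (\<integral>\<^sup>+t. indicator {a / b..b / a} t *
      ennreal (indicator (ball 0 b - cball 0 a) (t *\<^sub>R x) *\<^sub>R norm (gradient u (z + t *\<^sub>R x)) powr p) \<partial>lborel)"
proof -
  define N where "N = norm x"
  have N: "a < N" "N \<le> b" "N > 0" using x ab by (auto simp: N_def)
  define c d where "c = a / N" and "d = b / N"
  have cd: "c < d" "c > 0" using N ab by (simp_all add: c_def d_def divide_strict_right_mono)
  define k where "k t = norm (gradient u (z + t *\<^sub>R x)) powr p" for t
  have in_G: "z + t *\<^sub>R x \<in> G" if "t \<in> {c..d}" for t
  proof -
    have "t * N \<le> b" "0 < t" using that N cd by (auto simp: d_def field_simps)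
    then have "z + t *\<^sub>R x \<in> cball z b" by (simp add: dist_norm N_def)
    then show ?thesis using G by blast
  qed
  have grad_cont: "continuous_on {c..d} (\<lambda>t. gradient u (z + t *\<^sub>R x))"
  proof (rule continuous_on_compose2[of G "gradient u" "{c..d}" "\<lambda>t. z + t *\<^sub>R x"])
    show "continuous_on G (gradient u)" using u by (simp add: C1_on_def)
    show "continuous_on {c..d} (\<lambda>t. z + t *\<^sub>R x)" by (intro continuous_intros)
  qed (use in_G in auto)
  have k_cont: "continuous_on {c..d} k"
    unfolding k_def using p by (intro continuous_on_powr' continuous_intros grad_cont) auto
  have deriv: "((\<lambda>t. u (z + t *\<^sub>R x)) has_real_derivative (x \<bullet> gradient u (z + t *\<^sub>R x)))
      (at t within {c..d})" if "t \<in> {c..d}" for t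
  proof -
    have "(u has_derivative (\<lambda>h. h \<bullet> gradient u (z + t *\<^sub>R x))) (at (z + t *\<^sub>R x))"
      using C1_on_GDERIV[OF u in_G[OF that]] by (simp add: gderiv_def)
    moreover have "((\<lambda>t. z + t *\<^sub>R x) has_derivative (\<lambda>h. h *\<^sub>R x)) (at t within {c..d})"
      by (auto intro!: derivative_eq_intros)
    ultimately have "((\<lambda>t. u (z + t *\<^sub>R x)) has_derivative
        (\<lambda>h. (h *\<^sub>R x) \<bullet> gradient u (z + t *\<^sub>R x))) (at t within {c..d})"
      using has_derivative_compose by blast
    then show ?thesis
      by (simp add: has_field_derivative_def mult.commute[of _ "x \<bullet> gradient u (z + t *\<^sub>R x)"])
  qed
  have v'_cont: "continuous_on {c..d} (\<lambda>t. x \<bullet> gradient u (z + t *\<^sub>R x))"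
    by (intro continuous_intros grad_cont)
  have "d *\<^sub>R x = b *\<^sub>R sgn x" "c *\<^sub>R x = a *\<^sub>R sgn x"
    by (simp_all add: d_def c_def sgn_div_norm N_def divide_inverse)
  moreover have "z + a *\<^sub>R sgn x \<in> sphere z a"
    using N ab by (auto simp: dist_norm norm_sgn N_def)
  ultimately have "\<bar>u (z + b *\<^sub>R sgn x)\<bar> powr p = \<bar>u (z + d *\<^sub>R x) - u (z + c *\<^sub>R x)\<bar> powr p"
    by (simp add: zero)
  also have "\<dots> \<le> (d - c) powr (p - 1) * integral {c..d} (\<lambda>t. \<bar>x \<bullet> gradient u (z + t *\<^sub>R x)\<bar> powr p)"
    by (rule abs_diff_powr_le_integral[OF cd(1) p deriv v'_cont])
  also have "\<dots> \<le> (d - c) powr (p - 1) * integral {c..d} (\<lambda>t. N powr p * k t)"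
  proof (intro mult_left_mono integral_le integrable_continuous_real)
    show "continuous_on {c..d} (\<lambda>t. \<bar>x \<bullet> gradient u (z + t *\<^sub>R x)\<bar> powr p)"
      using p by (intro continuous_on_powr' continuous_intros v'_cont) auto
    show "continuous_on {c..d} (\<lambda>t. N powr p * k t)"
      by (intro continuous_intros k_cont)
    show "\<bar>x \<bullet> gradient u (z + t *\<^sub>R x)\<bar> powr p \<le> N powr p * k t" for t
    proof -
      have "\<bar>x \<bullet> gradient u (z + t *\<^sub>R x)\<bar> powr p \<le> (N * norm (gradient u (z + t *\<^sub>R x))) powr p"
        using p by (intro powr_mono2) (auto simp: N_def Cauchy_Schwarz_ineq2)
      then show ?thesis using N by (simp add: powr_mult k_def)
    qed
  qed simp
  also have "\<dots> = (d - c) powr (p - 1) * N powr p * integral {c..d} k"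
    by simp
  \<comment> \<open>Since d - c = (b - a) / N, all powers of \<open>N\<close> but one cancel; the
    remaining \<open>N\<close> is then bounded by \<open>b\<close>.\<close>
  also have "(d - c) powr (p - 1) * N powr p = (b - a) powr (p - 1) * N"
  proof -
    have "d - c = (b - a) / N" by (simp add: c_def d_def diff_divide_distrib)
    moreover have "N powr p = N powr (p - 1) * N" using N by (simp add: powr_diff)
    ultimately show ?thesis using N ab by (simp add: powr_divide)
  qed
  also have "(b - a) powr (p - 1) * N * integral {c..d} k \<le> (b - a) powr (p - 1) * b * integral {c..d} k"
    using N k_cont by (intro mult_right_mono mult_left_mono integral_nonneg integrable_continuous_real)
      (auto simp: k_def)
  finally have "ennreal (\<bar>u (z + b *\<^sub>R sgn x)\<bar> powr p) \<le>
      ennreal ((b - a) powr (p - 1) * b * integral {c..d} k)"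
    by (rule ennreal_leI)
  also have "\<dots> = ennreal ((b - a) powr (p - 1) * b) * ennreal (integral {c..d} k)"
    using ab by (intro ennreal_mult') simp
  \<comment> \<open>The open interval matches the open ball in \<open>dirichlet_energy\<close>: at
    \<open>t = d\<close> the point lies on the outer sphere, where the indicator is 0.\<close>
  also have "ennreal (integral {c..d} k) = (\<integral>\<^sup>+t. ennreal (indicator {c<..<d} t * k t) \<partial>lborel)"
  proof (rule nn_integral_has_integral_lebesgue[symmetric])
    show "(k has_integral integral {c..d} k) {c<..<d}"
      using k_cont by (intro has_integral_Icc_iff_Ioo[THEN iffD1] integrable_integral
          integrable_continuous_real)
  qed (simp add: k_def)
  also have "ennreal ((b - a) powr (p - 1) * b) * \<dots> \<le> ennreal ((b - a) powr (p - 1) * b) *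
    (\<integral>\<^sup>+t. indicator {a / b..b / a} t *
      ennreal (indicator (ball 0 b - cball 0 a) (t *\<^sub>R x) *\<^sub>R norm (gradient u (z + t *\<^sub>R x)) powr p) \<partial>lborel)"
  proof (intro mult_left_mono nn_integral_mono)
    fix t
    show "ennreal (indicator {c<..<d} t * k t) \<le> indicator {a / b..b / a} t *
      ennreal (indicator (ball 0 b - cball 0 a) (t *\<^sub>R x) *\<^sub>R norm (gradient u (z + t *\<^sub>R x)) powr p)"
    proof (cases "t \<in> {c<..<d}")
      case True
      have t: "a < t * N" "t * N < b"
        using True N by (auto simp: c_def d_def field_simps)
      have "0 < t" using True cd by simp
      have "a / b \<le> c" "d \<le> b / a"
        using N ab by (auto simp: c_def d_def intro!: divide_left_mono)
      then have "t \<in> {a / b..b / a}" using True by auto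
      moreover have "t *\<^sub>R x \<in> ball 0 b - cball 0 a"
        using t \<open>0 < t\<close> by (simp add: N_def)
      ultimately show ?thesis using True by (simp add: k_def)
    qed simp
  qed simp
  finally show ?thesis .
qed

lemma dirichlet_energy_nonneg: "dirichlet_energy p u z r \<ge> 0"
  unfolding dirichlet_energy_def set_lebesgue_integral_def by (intro integral_nonneg_AE) simp

text \<open>The equality depends on integrability, since a divergent Bochner integral would be 0. It
  holds because the gradient is continuous on the compact closed ball.\<close>

lemma ennreal_dirichlet_energy:
  fixes u :: "'a::euclidean_space \<Rightarrow> real"
  assumes u: "C1_on G u" and G: "cball z r \<subseteq> G" and p: "p > 0"
  shows "ennreal (dirichlet_energy p u z r) =
    (\<integral>\<^sup>+x. ennreal (indicator (ball 0 r) x *\<^sub>R norm (gradient u (z + x)) powr p) \<partial>lborel)"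
proof -
  define f where "f x = indicator (ball z r) x *\<^sub>R norm (gradient u x) powr p" for x
  have "continuous_on (cball z r) (\<lambda>x. norm (gradient u x) powr p)"
    using u G p by (intro continuous_on_powr' continuous_intros)
      (auto simp: C1_on_def intro: continuous_on_subset)
  then have "integrable lborel (\<lambda>x. indicator (cball z r) x *\<^sub>R norm (gradient u x) powr p)"
    by (intro borel_integrable_compact) auto
  then have "integrable lborel (\<lambda>x. indicator (ball z r) x *\<^sub>R indicator (cball z r) x *\<^sub>R norm (gradient u x) powr p)"
    by (rule integrable_mult_indicator[rotated]) auto
  also have "(\<lambda>x. indicator (ball z r) x *\<^sub>R indicator (cball z r) x *\<^sub>R norm (gradient u x) powr p) = f"
    by (auto simp: f_def indicator_def fun_eq_iff)
  finally have int: "integrable lborel f" .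
  have "dirichlet_energy p u z r = integral\<^sup>L lborel f"
    unfolding dirichlet_energy_def set_lebesgue_integral_def f_def[symmetric]
    using borel_measurable_integrable[OF int] by (rule integral_completion)
  then have "ennreal (dirichlet_energy p u z r) = (\<integral>\<^sup>+x. ennreal (f x) \<partial>lborel)"
    using nn_integral_eq_integral[OF int] by (simp add: f_def)
  also have "\<dots> = (\<integral>\<^sup>+x. ennreal (f (z + x)) \<partial>lborel)"
    using nn_integral_lborel_affine[of "\<lambda>x. ennreal (f x)" 1 z] borel_measurable_integrable[OF int]
    by simp
  also have "\<dots> = (\<integral>\<^sup>+x. ennreal (indicator (ball 0 r) x *\<^sub>R norm (gradient u (z + x)) powr p) \<partial>lborel)"
    by (intro nn_integral_cong) (simp add: f_def indicator_def dist_norm)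
  finally show ?thesis .
qed

text \<open>The function \<open>h\<close> in the proof depends only on the direction of
  \<open>x\<close>, so its integral over the annulus is (b^n - a^n) H, where \<open>H\<close> is its
  integral over the unit ball and I(b) = n b^(n-1) H. The ray estimate bounds the same annulus
  integral, and averaging over dilations in [a / b, b / a] produces the factor (b / a - a / b) / (a
  / b)^n.\<close>

lemma sphere_energy_le_dirichlet_energy:
  fixes u :: "'a::euclidean_space \<Rightarrow> real" and a b p :: real
  assumes u: "C1_on G u" and G: "cball z b \<subseteq> G" and ab: "0 < a" "a < b" and p: "p > 1"
    and zero: "\<And>x. x \<in> sphere z a \<Longrightarrow> u x = 0"
  shows "(b ^ DIM('a) - a ^ DIM('a)) * sphere_energy p u z b \<le>
    DIM('a) * b ^ (DIM('a) - 1) * ((b - a) powr (p - 1) * b *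
      ((b / a - a / b) / (a / b) ^ DIM('a) * dirichlet_energy p u z b))"
proof -
  \<comment> \<open>The indicator excludes only the origin, rather than cutting off at the unit
    ball, so that \<open>h\<close> is invariant under every positive dilation.\<close>
  define h where "h x = ennreal (indicator (- {0}) x *\<^sub>R \<bar>u (z + b *\<^sub>R sgn x)\<bar> powr p)" for x
  define g where "g x = ennreal (indicator (ball 0 b - cball 0 a) x *\<^sub>R norm (gradient u (z + x)) powr p)" for x
  define H where "H = (\<integral>\<^sup>+x. indicator (cball 0 1) x * h x \<partial>lborel)"
  define \<Theta> where "\<Theta> = (b / a - a / b) / (a / b) ^ DIM('a) * dirichlet_energy p u z b"
  define D where "D = dirichlet_energy p u z b"
  have q_nonneg: "0 \<le> (b / a - a / b) / (a / b) ^ DIM('a)"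
    using ab mult_strict_mono[of a b a b] by (intro divide_nonneg_nonneg) (auto simp: field_simps)
  then have Theta: "\<Theta> \<ge> 0"
    unfolding \<Theta>_def by (intro mult_nonneg_nonneg dirichlet_energy_nonneg)
  have u_cont: "continuous_on (cball z b) u"
    using C1_on_imp_continuous_on[OF u] G by (rule continuous_on_subset)
  have in_sphere: "z + b *\<^sub>R sgn x \<in> sphere z b" if "x \<noteq> 0" for x
    using that ab by (simp add: dist_norm norm_sgn)
  have h_meas[measurable]: "h \<in> borel_measurable borel"
    unfolding h_def
  proof (intro measurable_compose[OF _ measurable_ennreal] borel_measurable_continuous_on_indicator)
    have "continuous_on (- {0}) (\<lambda>x. u (z + b *\<^sub>R sgn x))"
      by (rule continuous_on_compose2[OF u_cont]) (use ab in \<open>auto intro!: continuous_intros simp: dist_norm norm_sgn split: if_splits\<close>)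
    then show "continuous_on (- {0}) (\<lambda>x. \<bar>u (z + b *\<^sub>R sgn x)\<bar> powr p)"
      using p by (intro continuous_on_powr' continuous_intros) auto
  qed simp
  have g_meas[measurable]: "g \<in> borel_measurable borel"
    unfolding g_def
  proof (intro measurable_compose[OF _ measurable_ennreal] borel_measurable_continuous_on_indicator)
    have "continuous_on (ball 0 b - cball 0 a) (\<lambda>x. gradient u (z + x))"
      by (rule continuous_on_compose2[of G "gradient u"])
        (use u G in \<open>auto simp: C1_on_def dist_norm intro!: continuous_intros\<close>)
    then show "continuous_on (ball 0 b - cball 0 a) (\<lambda>x. norm (gradient u (z + x)) powr p)"
      using p by (intro continuous_on_powr' continuous_intros) auto
  qed simp
  obtain B where B: "B \<ge> 0" "\<And>x. x \<in> cball z b \<Longrightarrow> norm (u x) \<le> B"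
    using continuous_on_compact_bound[OF compact_cball u_cont] by blast
  \<comment> \<open>The term a^n H will be moved across an inequality, which requires
    \<open>H\<close> to be finite.\<close>
  have "H \<le> (\<integral>\<^sup>+x. ennreal (B powr p) * indicator (cball (0::'a) 1) x \<partial>lborel)"
    unfolding H_def
  proof (intro nn_integral_mono)
    fix x :: 'a
    have "\<bar>u (z + b *\<^sub>R sgn x)\<bar> powr p \<le> B powr p" if "x \<noteq> 0"
      using B(2)[of "z + b *\<^sub>R sgn x"] in_sphere[OF that] p by (intro powr_mono2) auto
    then show "indicator (cball 0 1) x * h x \<le> ennreal (B powr p) * indicator (cball 0 1) x"
      by (auto simp: h_def indicator_def intro!: ennreal_leI)
  qed
  also have "\<dots> < \<infinity>"
    by (subst nn_integral_cmult_indicator) (auto simp: ennreal_mult_less_top emeasure_cball)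
  finally have "H \<noteq> \<infinity>" by simp
  then obtain Hr where Hr: "H = ennreal Hr" "Hr \<ge> 0"
    by (cases H) auto
  have "(\<integral>\<^sup>+x. indicator (cball 0 b - cball 0 a) x * h x \<partial>lborel) \<le>
      (\<integral>\<^sup>+x. ennreal ((b - a) powr (p - 1) * b) *
        (\<integral>\<^sup>+t. indicator {a / b..b / a} t * g (t *\<^sub>R x) \<partial>lborel) \<partial>lborel)"
  proof (rule nn_integral_mono)
    fix x :: 'a
    show "indicator (cball 0 b - cball 0 a) x * h x \<le> ennreal ((b - a) powr (p - 1) * b) *
        (\<integral>\<^sup>+t. indicator {a / b..b / a} t * g (t *\<^sub>R x) \<partial>lborel)"
    proof (cases "x \<in> cball 0 b - cball 0 a")
      case True
      then have "x \<noteq> 0" using ab by auto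
      then show ?thesis
        using ray_powr_le_nn_integral[OF u G ab p zero True] True by (simp add: h_def g_def)
    qed simp
  qed
  also have "\<dots> = ennreal ((b - a) powr (p - 1) * b) *
      (\<integral>\<^sup>+x. (\<integral>\<^sup>+t. indicator {a / b..b / a} t * g (t *\<^sub>R x) \<partial>lborel) \<partial>lborel)"
    by (rule nn_integral_cmult) measurable
  also have "\<dots> \<le> ennreal ((b - a) powr (p - 1) * b) *
      (ennreal ((b / a - a / b) / (a / b) ^ DIM('a)) * (\<integral>\<^sup>+x. g x \<partial>lborel))"
    using ab mult_strict_mono[of a b a b]
    by (intro mult_left_mono nn_integral_dilations_le g_meas) (auto simp: field_simps)
  also have "\<dots> \<le> ennreal ((b - a) powr (p - 1) * b) *
      (ennreal ((b / a - a / b) / (a / b) ^ DIM('a)) * ennreal D)"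
  proof (intro mult_left_mono)
    show "(\<integral>\<^sup>+x. g x \<partial>lborel) \<le> ennreal D"
      using p unfolding D_def
      by (subst ennreal_dirichlet_energy[OF u G])
        (auto simp: g_def indicator_def intro!: nn_integral_mono)
  qed auto
  also have "\<dots> = ennreal ((b - a) powr (p - 1) * b) * ennreal \<Theta>"
    using q_nonneg dirichlet_energy_nonneg unfolding \<Theta>_def D_def by (subst ennreal_mult) auto
  also have "\<dots> = ennreal ((b - a) powr (p - 1) * b * \<Theta>)"
    using ab Theta by (intro ennreal_mult[symmetric]) auto
  finally have annulus: "(\<integral>\<^sup>+x. indicator (cball 0 b - cball 0 a) x * h x \<partial>lborel) \<le>
      ennreal ((b - a) powr (p - 1) * b * \<Theta>)" .
  have "ennreal (b ^ DIM('a)) * H = ennreal (a ^ DIM('a)) * H +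
      (\<integral>\<^sup>+x. indicator (cball 0 b - cball 0 a) x * h x \<partial>lborel)"
    unfolding H_def using ab
    by (intro nn_integral_annulus_homogeneous h_meas) (auto simp: h_def sgn_scaleR indicator_def)
  also have "\<dots> \<le> ennreal (a ^ DIM('a)) * H + ennreal ((b - a) powr (p - 1) * b * \<Theta>)"
    using annulus by (rule add_left_mono)
  finally have "ennreal (b ^ DIM('a) * Hr) \<le> ennreal (a ^ DIM('a) * Hr + (b - a) powr (p - 1) * b * \<Theta>)"
    using ab Hr(2) Theta by (simp add: Hr(1) ennreal_mult ennreal_plus)
  then have "b ^ DIM('a) * Hr \<le> a ^ DIM('a) * Hr + (b - a) powr (p - 1) * b * \<Theta>"
    using ab Hr(2) Theta by (subst (asm) ennreal_le_iff) auto
  then have Hr_le: "(b ^ DIM('a) - a ^ DIM('a)) * Hr \<le> (b - a) powr (p - 1) * b * \<Theta>"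
    by (simp add: algebra_simps)
  have "continuous_on (sphere z b) u"
    using u_cont by (rule continuous_on_subset) auto
  then have "sphere_energy p u z b = enn2real (ennreal (real DIM('a) * b ^ (DIM('a) - 1)) *
      (\<integral>\<^sup>+x. ennreal (indicator (cball 0 1 - {0}) x *\<^sub>R \<bar>u (z + b *\<^sub>R sgn x)\<bar> powr p) \<partial>lborel))"
    using ab p by (intro sphere_energy_eq_enn2real) auto
  also have "(\<integral>\<^sup>+x. ennreal (indicator (cball 0 1 - {0}) x *\<^sub>R \<bar>u (z + b *\<^sub>R sgn x)\<bar> powr p) \<partial>lborel) = H"
    unfolding H_def by (intro nn_integral_cong) (auto simp: h_def indicator_def)
  finally have "sphere_energy p u z b = real DIM('a) * b ^ (DIM('a) - 1) * Hr"
    using ab Hr by (simp add: enn2real_mult)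
  then have "(b ^ DIM('a) - a ^ DIM('a)) * sphere_energy p u z b =
      real DIM('a) * b ^ (DIM('a) - 1) * ((b ^ DIM('a) - a ^ DIM('a)) * Hr)"
    by simp
  also have "\<dots> \<le> real DIM('a) * b ^ (DIM('a) - 1) * ((b - a) powr (p - 1) * b * \<Theta>)"
    using ab Hr_le by (intro mult_left_mono) auto
  finally show ?thesis by (simp add: \<Theta>_def)
qed

section \<open>Continuity and zeros of the sphere energy\<close>

lemma sphere_energy_eq_integral:
  fixes u :: "'a::euclidean_space \<Rightarrow> real"
  assumes u: "continuous_on (sphere z r) u" and r: "r > 0" and p: "p > 0"
  shows "sphere_energy p u z r = real DIM('a) * r ^ (DIM('a) - 1) *
    (\<integral>x. indicator (cball 0 1 - {0}) x *\<^sub>R \<bar>u (z + r *\<^sub>R sgn x)\<bar> powr p \<partial>lborel)"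
  unfolding sphere_energy_def using r p
  by (intro integral_sphere_measure continuous_on_powr' continuous_intros u) auto

lemma borel_measurable_polar:
  fixes u :: "'a::euclidean_space \<Rightarrow> real"
  assumes u: "continuous_on (sphere z r) u" and r: "r > 0" and p: "p > 0"
  shows "(\<lambda>x. indicator (cball 0 1 - {0}) x *\<^sub>R \<bar>u (z + r *\<^sub>R sgn x)\<bar> powr p) \<in> borel_measurable borel"
proof (intro borel_measurable_continuous_on_indicator)
  have "continuous_on (cball 0 1 - {0}) (\<lambda>x. u (z + r *\<^sub>R sgn x))"
    by (rule continuous_on_compose2[OF u])
      (use r in \<open>auto intro!: continuous_intros simp: dist_norm norm_sgn split: if_splits\<close>)
  then show "continuous_on (cball 0 1 - {0}) (\<lambda>x. \<bar>u (z + r *\<^sub>R sgn x)\<bar> powr p)"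
    using p by (intro continuous_on_powr' continuous_intros) auto
qed simp

text \<open>Over the unit ball only the integrand depends on the radius, so dominated convergence
  applies with majorant B^p, where \<open>B\<close> bounds |u| on the closed ball of radius
  \<open>R\<close>.\<close>

lemma continuous_on_sphere_energy:
  fixes u :: "'a::euclidean_space \<Rightarrow> real"
  assumes u: "continuous_on (cball z R) u" and p: "p > 0"
  shows "continuous_on {0<..R} (sphere_energy p u z)"
proof (rule continuous_on_sequentiallyI)
  fix s r assume s: "\<forall>n. s n \<in> {0<..R}" and r: "r \<in> {0<..R}" and lim: "s \<longlonglongrightarrow> r"
  define f where "f r x = indicator (cball 0 1 - {0}) x *\<^sub>R \<bar>u (z + r *\<^sub>R sgn x)\<bar> powr p" for r x
  have u_sphere: "continuous_on (sphere z \<rho>) u" if "\<rho> \<in> {0<..R}" for \<rho>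
    using u by (rule continuous_on_subset) (use that in auto)
  obtain B where B: "\<And>x. x \<in> cball z R \<Longrightarrow> norm (u x) \<le> B"
    using continuous_on_compact_bound[OF compact_cball u] by blast
  have in_cball: "z + \<rho> *\<^sub>R sgn x \<in> cball z R" if "\<rho> \<in> {0<..R}" for \<rho> x
    using that by (simp add: dist_norm norm_sgn)
  have "(\<lambda>n. integral\<^sup>L lborel (f (s n))) \<longlonglongrightarrow> integral\<^sup>L lborel (f r)"
  proof (rule integral_dominated_convergence)
    show "integrable lborel (\<lambda>x::'a. indicator (cball 0 1) x *\<^sub>R (B powr p))"
      by (intro borel_integrable_compact) auto
    show "AE x in lborel. (\<lambda>n. f (s n) x) \<longlonglongrightarrow> f r x"
    proof (rule AE_I2)
      fix x :: 'a
      have "(\<lambda>n. z + s n *\<^sub>R sgn x) \<longlonglongrightarrow> z + r *\<^sub>R sgn x"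
        by (intro tendsto_intros lim)
      then have "(\<lambda>n. u (z + s n *\<^sub>R sgn x)) \<longlonglongrightarrow> u (z + r *\<^sub>R sgn x)"
        using s r in_cball by (intro continuous_on_tendsto_compose[OF u]) (auto intro!: always_eventually simp del: mem_cball)
      then show "(\<lambda>n. f (s n) x) \<longlonglongrightarrow> f r x"
        unfolding f_def using p by (intro tendsto_intros tendsto_powr') auto
    qed
    show "AE x in lborel. norm (f (s n) x) \<le> indicator (cball 0 1) x *\<^sub>R (B powr p)" for n
      using s B[OF in_cball] p by (intro AE_I2) (auto simp: f_def indicator_def intro!: powr_mono2)
    show "f r \<in> borel_measurable lborel" "f (s n) \<in> borel_measurable lborel" for n
      using borel_measurable_polar[OF u_sphere _ p] r s by (auto simp: f_def[abs_def])
  qed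
  then have "(\<lambda>n. real DIM('a) * s n ^ (DIM('a) - 1) * integral\<^sup>L lborel (f (s n))) \<longlonglongrightarrow>
      real DIM('a) * r ^ (DIM('a) - 1) * integral\<^sup>L lborel (f r)"
    by (intro tendsto_intros lim)
  moreover have "sphere_energy p u z \<rho> = real DIM('a) * \<rho> ^ (DIM('a) - 1) * integral\<^sup>L lborel (f \<rho>)"
    if "\<rho> \<in> {0<..R}" for \<rho>
    using that p sphere_energy_eq_integral[OF u_sphere[OF that]] by (simp add: f_def[abs_def])
  ultimately show "(\<lambda>n. sphere_energy p u z (s n)) \<longlonglongrightarrow> sphere_energy p u z r"
    using s r by simp
qed

lemma sphere_energy_nonneg: "sphere_energy p u z r \<ge> 0"
  unfolding sphere_energy_def by (intro integral_nonneg_AE) simp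

text \<open>A zero integral makes the pulled-back integrand vanish almost everywhere. The points of
  the punctured open ball whose direction leads to a nonzero value of \<open>u\<close> form an open
  set, and a negligible open set is empty.\<close>

lemma sphere_energy_eq_0_imp:
  fixes u :: "'a::euclidean_space \<Rightarrow> real"
  assumes u: "continuous_on (sphere z r) u" and r: "r > 0" and p: "p > 0"
    and zero: "sphere_energy p u z r = 0" and y: "y \<in> sphere z r"
  shows "u y = 0"
proof (rule ccontr)
  assume "u y \<noteq> 0"
  define f where "f x = indicator (cball 0 1 - {0}) x *\<^sub>R \<bar>u (z + r *\<^sub>R sgn x)\<bar> powr p" for x
  have f_meas: "f \<in> borel_measurable borel"
    unfolding f_def using u r p by (rule borel_measurable_polar)
  obtain B where B: "\<And>x. x \<in> sphere z r \<Longrightarrow> norm (u x) \<le> B"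
    using continuous_on_compact_bound[OF compact_sphere u] by blast
  have in_sphere: "z + r *\<^sub>R sgn x \<in> sphere z r" if "x \<noteq> 0" for x
    using that r by (simp add: dist_norm norm_sgn)
  have "integrable lborel f"
  proof (rule Bochner_Integration.integrable_bound)
    show "integrable lborel (\<lambda>x::'a. indicator (cball 0 1) x *\<^sub>R (B powr p))"
      by (intro borel_integrable_compact) auto
    show "f \<in> borel_measurable lborel" using f_meas by simp
    show "AE x in lborel. norm (f x) \<le> norm (indicator (cball 0 1) x *\<^sub>R (B powr p))"
      using B[OF in_sphere] p by (intro AE_I2) (auto simp: f_def indicator_def intro!: powr_mono2)
  qed
  moreover have "integral\<^sup>L lborel f = 0"
    using zero r sphere_energy_eq_integral[OF u r p] by (simp add: f_def[abs_def])
  ultimately have "AE x in lborel. f x = 0"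
    by (subst (asm) integral_nonneg_eq_0_iff_AE) (auto simp: f_def)
  then have "{x. f x \<noteq> 0} \<in> null_sets lborel"
    using f_meas by (subst (asm) AE_iff_null) auto
  then have null: "negligible {x. f x \<noteq> 0}"
    by (simp add: negligible_iff_null_sets null_sets_completionI)
  define S where "S = (ball 0 1 - {0}) \<inter> (\<lambda>x. u (z + r *\<^sub>R sgn x)) -` (- {0})"
  have "continuous_on (ball 0 1 - {0}) (\<lambda>x. u (z + r *\<^sub>R sgn x))"
    by (rule continuous_on_compose2[OF u])
      (use r in \<open>auto intro!: continuous_intros simp: dist_norm norm_sgn split: if_splits\<close>)
  then have "open S"
    unfolding S_def by (rule continuous_open_preimage) auto
  moreover have "S \<subseteq> {x. f x \<noteq> 0}"
    by (auto simp: S_def f_def)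
  then have "negligible S" using null negligible_subset by blast
  ultimately have "S = {}" using open_not_negligible by blast
  \<comment> \<open>This point has norm 1/2 and the direction of \<open>y - z\<close>, so it
    projects back to \<open>y\<close>.\<close>
  moreover have "(1 / (2 * r)) *\<^sub>R (y - z) \<in> S"
    using y r \<open>u y \<noteq> 0\<close>
    by (auto simp: S_def dist_norm norm_minus_commute sgn_scaleR sgn_div_norm)
  ultimately show False by simp
qed

section \<open>Positivity of the sphere energy at the inner radius\<close>

text \<open>A factor b - a cancels in the two-sphere estimate: b^n - a^n \<ge> (b - a) a^(n-1) on
  the left, b / a - a / b \<le> (b - a) 2R / a^2 on the right. What remains is (b - a)^(p-1) and
  factors bounded uniformly through a < b \<le> R.\<close>

lemma sphere_energy_poincare:
  fixes u :: "'a::euclidean_space \<Rightarrow> real" and a R p :: real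
  assumes u: "C1_on G u" and G: "cball z R \<subseteq> G" and a: "0 < a" "a < R" and p: "p > 1"
    and zero: "\<And>x. x \<in> sphere z a \<Longrightarrow> u x = 0"
  shows "\<exists>K\<ge>0. \<forall>b\<in>{a<..R}. sphere_energy p u z b \<le> K * (b - a) powr (p - 1) * dirichlet_energy p u z b"
proof (intro exI conjI ballI)
  let ?n = "DIM('a)"
  \<comment> \<open>The numerator collects the upper bounds for the right-hand factors; the
    denominator comes from the lower bound for b^n - a^n.\<close>
  define K where "K = ?n * R ^ (?n - 1) * (R * (2 * R / a\<^sup>2 * (R / a) ^ ?n)) / a ^ (?n - 1)"
  show "K \<ge> 0" using a by (simp add: K_def)
  fix b assume b: "b \<in> {a<..R}"
  then have ab: "0 < a" "a < b" "b \<le> R" using a by auto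
  define I where "I = sphere_energy p u z b"
  define D where "D = dirichlet_energy p u z b"
  have I0: "I \<ge> 0" and D0: "D \<ge> 0"
    by (simp_all add: I_def D_def sphere_energy_nonneg dirichlet_energy_nonneg)
  have "(b - a) * a ^ (?n - 1) \<le> b ^ ?n - a ^ ?n"
  proof -
    have "b * a ^ (?n - 1) \<le> b * b ^ (?n - 1)"
      using ab by (intro mult_left_mono power_mono) auto
    then show ?thesis by (simp add: left_diff_distrib power_eq_if)
  qed
  then have "(b - a) * a ^ (?n - 1) * I \<le> (b ^ ?n - a ^ ?n) * I"
    using I0 by (rule mult_right_mono)
  also have "\<dots> \<le> ?n * b ^ (?n - 1) * ((b - a) powr (p - 1) * b *
      ((b / a - a / b) / (a / b) ^ ?n * D))"
    unfolding I_def D_def using G ab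
    by (intro sphere_energy_le_dirichlet_energy[OF u _ _ _ p zero]) auto
  also have "\<dots> \<le> ?n * R ^ (?n - 1) * ((b - a) powr (p - 1) * R *
      (((b - a) * (2 * R / a\<^sup>2) * (R / a) ^ ?n) * D))"
  proof -
    have "b / a - a / b = (b - a) * ((b + a) / (b * a))"
      using ab by (simp add: field_simps)
    also have "\<dots> \<le> (b - a) * (2 * R / a\<^sup>2)"
      unfolding power2_eq_square using ab by (intro mult_left_mono frac_le mult_right_mono) auto
    finally have 1: "b / a - a / b \<le> (b - a) * (2 * R / a\<^sup>2)" .
    have 2: "0 \<le> b / a - a / b"
      using ab mult_strict_mono[of a b a b] by (auto simp: field_simps)
    have "(b / a - a / b) / (a / b) ^ ?n = (b / a - a / b) * (b / a) ^ ?n"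
      by (simp add: power_divide)
    also have "\<dots> \<le> (b - a) * (2 * R / a\<^sup>2) * (R / a) ^ ?n"
      using 1 2 ab by (intro mult_mono power_mono divide_right_mono) auto
    finally have 3: "(b / a - a / b) / (a / b) ^ ?n \<le> (b - a) * (2 * R / a\<^sup>2) * (R / a) ^ ?n" .
    have 4: "0 \<le> (b / a - a / b) / (a / b) ^ ?n" using 2 ab by simp
    show ?thesis
      using ab 3 4 D0 by (intro mult_mono power_mono mult_nonneg_nonneg zero_le_power powr_ge_zero) auto
  qed
  also have "\<dots> = (b - a) * a ^ (?n - 1) * (K * (b - a) powr (p - 1) * D)"
    using ab by (simp add: K_def)
  finally show "sphere_energy p u z b \<le> K * (b - a) powr (p - 1) * dirichlet_energy p u z b"
    using ab by (simp add: I_def D_def)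
qed

text \<open>The frequency bound is known only almost everywhere, so one bad radius is no
  contradiction. If I(a) = 0, however, a whole open interval to the right of \<open>a\<close>
  violates the bound.\<close>

lemma sphere_energy_pos_of_frequency_bounded:
  fixes u :: "'a::euclidean_space \<Rightarrow> real" and a R p :: real
  assumes u: "C1_on G u" and G: "cball z R \<subseteq> G" and a: "0 < a" "a < R" and p: "p > 1"
    and pos: "\<And>r. r \<in> {a<..R} \<Longrightarrow> sphere_energy p u z r > 0"
    and freq: "Linfty_norm {a<..R} (frequency p u z) < \<infinity>"
  shows "sphere_energy p u z a > 0"
proof (rule ccontr)
  assume "\<not> ?thesis"
  then have "sphere_energy p u z a = 0"
    using sphere_energy_nonneg[of p u z a] by linarith
  moreover have "continuous_on (sphere z a) u"
    using C1_on_imp_continuous_on[OF u] by (rule continuous_on_subset) (use G a in auto)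
  ultimately have zero: "u x = 0" if "x \<in> sphere z a" for x
    using sphere_energy_eq_0_imp[of z a u p x] a p that by simp
  obtain K where K: "K \<ge> 0"
    "\<And>r. r \<in> {a<..R} \<Longrightarrow> sphere_energy p u z r \<le> K * (r - a) powr (p - 1) * dirichlet_energy p u z r"
    using sphere_energy_poincare[OF u G a p zero] by blast
  \<comment> \<open>The norm is an extended real: \<open>max m 1\<close> keeps the bound positive,
    and \<open>M = 1\<close> covers the value minus infinity.\<close>
  obtain M where M: "M > 0" "Linfty_norm {a<..R} (frequency p u z) \<le> ereal M"
  proof (cases "Linfty_norm {a<..R} (frequency p u z)")
    case (real m)
    then show ?thesis by (intro that[of "max m 1"]) auto
  qed (use freq that[of 1] in auto)
  have "AE r in lebesgue_on {a<..R}. ereal \<bar>frequency p u z r\<bar> \<le> Linfty_norm {a<..R} (frequency p u z)"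
    unfolding Linfty_norm_def by (rule esssup_AE)
  then have "AE r in lebesgue_on {a<..R}. \<bar>frequency p u z r\<bar> \<le> M"
    by eventually_elim (metis M(2) order_trans ereal_less_eq(3))
  then have AE: "AE r in lebesgue. r \<in> {a<..R} \<longrightarrow> \<bar>frequency p u z r\<bar> \<le> M"
    by (subst (asm) AE_restrict_space_iff) auto
  \<comment> \<open>The limit is 0, because \<open>0 powr (p - 1) = 0\<close> and p > 1 gives
    continuity there.\<close>
  have "((\<lambda>r. K * M * (r - a) powr (p - 1)) \<longlongrightarrow> K * M * (a - a) powr (p - 1)) (at_right a)"
    using p by (intro tendsto_intros tendsto_powr') (auto simp: eventually_at_right_less eventually_at_filter)
  then have "eventually (\<lambda>r. K * M * (r - a) powr (p - 1) < a) (at_right a)"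
    using a p by (intro order_tendstoD(2)) auto
  then obtain c where c: "c > a" "\<And>r. a < r \<Longrightarrow> r < c \<Longrightarrow> K * M * (r - a) powr (p - 1) < a"
    unfolding eventually_at_right_field by blast
  define S where "S = {a<..<min c R}"
  have bound: "\<not> \<bar>frequency p u z r\<bar> \<le> M" if "r \<in> S" for r
  proof
    assume F: "\<bar>frequency p u z r\<bar> \<le> M"
    have r: "a < r" "r < c" "r \<in> {a<..R}" using that by (auto simp: S_def)
    have I: "sphere_energy p u z r > 0" using pos r by blast
    have "r * dirichlet_energy p u z r / sphere_energy p u z r \<le> M"
      using F unfolding frequency_def by linarith
    then have "r * dirichlet_energy p u z r \<le> M * sphere_energy p u z r"
      using I by (simp add: divide_le_eq)
    \<comment> \<open>The Poincare inequality bounds r I by K (r - a)^(p-1) r D, and the frequency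
      bound replaces r D by M I; then I > 0 cancels.\<close>
    then have "K * (r - a) powr (p - 1) * (r * dirichlet_energy p u z r) \<le>
        K * (r - a) powr (p - 1) * (M * sphere_energy p u z r)"
      using K(1) by (intro mult_left_mono) auto
    moreover have "a * sphere_energy p u z r \<le> r * sphere_energy p u z r"
      using I r by (intro mult_right_mono) auto
    moreover have "r * sphere_energy p u z r \<le> r * (K * (r - a) powr (p - 1) * dirichlet_energy p u z r)"
      using K(2)[OF r(3)] r a by (intro mult_left_mono) auto
    ultimately have "a * sphere_energy p u z r \<le> (K * M * (r - a) powr (p - 1)) * sphere_energy p u z r"
      by (simp add: mult_ac)
    then have "a \<le> K * M * (r - a) powr (p - 1)"
      using I by simp
    then show False using c(2)[OF r(1,2)] by simp
  qed
  have "AE r in lebesgue. r \<notin> S"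
    using AE
  proof eventually_elim
    case (elim r)
    then show ?case using bound[of r] by (auto simp: S_def)
  qed
  then have "negligible S"
    by (subst (asm) AE_iff_null_sets[symmetric]) (auto simp: S_def negligible_iff_null_sets)
  moreover have "open S" "S \<noteq> {}"
    using a c(1) by (auto simp: S_def)
  ultimately show False using open_not_negligible by blast
qed

section \<open>Comparison near the inner radius\<close>

theorem theorem2p4:
  fixes G :: "(real ^ 'n) set" and u :: "real ^ 'n \<Rightarrow> real" and z :: "real ^ 'n"
    and p r\<^sub>b R\<^sub>b :: real
  assumes "CARD('n) \<ge> 2" and "1 < p"
    and "open G" and "connected G" and "C1_on G u"
    and "0 < r\<^sub>b" and "r\<^sub>b < R\<^sub>b"
    and "ball z r\<^sub>b \<subseteq> cball z R\<^sub>b" and "cball z R\<^sub>b \<subseteq> G"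
    and "\<And>r. r \<in> {r\<^sub>b<..R\<^sub>b} \<Longrightarrow> sphere_energy p u z r > 0"
    and "Linfty_norm {r\<^sub>b<..R\<^sub>b} (frequency p u z) < \<infinity>"
  shows "\<exists>r'\<in>{r\<^sub>b<..R\<^sub>b}.
      (\<forall>r1\<in>{r\<^sub>b<..r'}. \<forall>r2\<in>{r\<^sub>b<..r'}. sphere_energy p u z r1 \<le> 4 * sphere_energy p u z r2) \<and>
      (\<forall>r\<in>{r\<^sub>b<..r'}. sphere_energy p u z r' \<le> 4 * sphere_energy p u z r)"
proof -
  define c where "c = sphere_energy p u z r\<^sub>b"
  have c: "c > 0"
    unfolding c_def using assms(5,9,6,7,2,10,11) by (rule sphere_energy_pos_of_frequency_bounded)
  have "continuous_on (cball z R\<^sub>b) u"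
    using C1_on_imp_continuous_on[OF assms(5)] assms(9) by (rule continuous_on_subset)
  then have "continuous_on {0<..R\<^sub>b} (sphere_energy p u z)"
    using assms(2) by (intro continuous_on_sphere_energy) auto
  moreover have "r\<^sub>b \<in> {0<..R\<^sub>b}" using assms(6,7) by auto
  \<comment> \<open>Tolerance c / 2 confines \<open>I\<close> to the interval from c / 2 to 3 c / 2,
    so two nearby values differ by a factor below 3.\<close>
  ultimately obtain d where d: "d > 0"
    "\<And>r. r \<in> {0<..R\<^sub>b} \<Longrightarrow> dist r r\<^sub>b < d \<Longrightarrow> dist (sphere_energy p u z r) c < c / 2"
    using half_gt_zero[OF c] unfolding continuous_on_iff c_def by blast
  \<comment> \<open>Taking d / 2 keeps the closed endpoint \<open>r'\<close> strictly within
    distance \<open>d\<close> of \<open>r\<^sub>b\<close>.\<close>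
  define r' where "r' = min R\<^sub>b (r\<^sub>b + d / 2)"
  have r': "r' \<in> {r\<^sub>b<..R\<^sub>b}" using assms(7) d by (auto simp: r'_def)
  have near: "c / 2 < sphere_energy p u z r \<and> sphere_energy p u z r < 3 * c / 2"
    if "r \<in> {r\<^sub>b<..r'}" for r
  proof -
    have "dist (sphere_energy p u z r) c < c / 2"
      using that assms(6) d(1) by (intro d(2)) (auto simp: r'_def dist_real_def)
    then show ?thesis unfolding dist_real_def by (intro conjI; linarith)
  qed
  have "sphere_energy p u z r1 \<le> 4 * sphere_energy p u z r2"
    if "r1 \<in> {r\<^sub>b<..r'}" "r2 \<in> {r\<^sub>b<..r'}" for r1 r2
    using near[OF that(1)] near[OF that(2)] c by linarith
  then show ?thesis using r' by (intro bexI[of _ r']) auto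
qed

end
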